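(* For every function $f\colon\{0,1\}^n\to\mathbb{R}$ and every $S\subseteq N$, the number $I_{\mathrm{B}}(f,S)$ is the coefficient of $u_S$ (i.e., the leading coefficient) in the multilinear representation of the best $S$-approximation $f_S$ of $f$.
   Context: Let $n\geqslant 1$ and $N=\{1,\ldots,n\}$. Boolean vectors $\mathbf{x}\in\{0,1\}^n$ are identified with subsets $T\subseteq N$ via $x_i=1\iff i\in T$; thus a pseudo-Boolean function $f\colon\{0,1\}^n\to\mathbb{R}$ is also regarded as a set function $f\colon 2^N\to\mathbb{R}$. For $T\subseteq N$ let $u_T(\mathbf{x})=\prod_{i\in T}x_i$ (with $u_\varnothing=1$). Every pseudo-Boolean function has a unique multilinear representation $f=\sum_{T\subseteq N}a(T)\,u_T$ with $a(T)\in\mathbb{R}$. Differences: $\Delta_\varnothing f=f$, $\Delta_{\{i\}}f(\mathbf{x})=f(\mathbf{x}\mid x_i=1)-f(\mathbf{x}\mid x_i=0)$, and $\Delta_Sf=\Delta_{\{i\}}\Delta_{S\setminus\{i\}}f$ for $i\in S$. The Banzhaf interaction index is $$I_{\mathrm{B}}(f,S)=\frac{1}{2^{n-|S|}}\sum_{T\subseteq N\setminus S}(\Delta_Sf)(T).$$ For $S\subseteq N$ let $V_S$ be the linear span of $\{u_T:T\subseteq S\}$, i.e., the space of functions $\{0,1\}^n\to\mathbb{R}$ depending only on the variables in $S$. The best $S$-approximation of $f$ is the unique $f_S\in V_S$ minimizing $\sum_{T\subseteq N}(f(T)-g(T))^2$ among all $g\in V_S$. *)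

theory Defs
  imports "HOL-Analysis.Analysis" "HOL-Library.Function_Algebras"
begin

text \<open>
  The index set \<open>N\<close> is the universe of a finite type \<open>'n\<close>, so \<open>n = CARD('n) \<ge> 1\<close>. A Boolean vector
  \<open>x\<close> is the subset of \<open>N\<close> on which its coordinates are \<open>1\<close>; its \<open>i\<close>-th coordinate is
  \<open>indicator x i\<close>. Below, \<open>unanimity T\<close> is the monomial \<open>u\<^sub>T\<close>.
\<close>

type_synonym 'n pseudo_boolean = "'n set \<Rightarrow> real"

definition unanimity :: "'n set \<Rightarrow> 'n pseudo_boolean" where
  "unanimity T x = (\<Prod>i\<in>T. indicator x i)"

definition is_multilinear_rep :: "'n::finite pseudo_boolean \<Rightarrow> ('n set \<Rightarrow> real) \<Rightarrow> bool" where
  "is_multilinear_rep f a \<longleftrightarrow> f = (\<lambda>x. \<Sum>T\<in>UNIV. a T * unanimity T x)"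

definition multilinear_coeff :: "'n::finite pseudo_boolean \<Rightarrow> 'n set \<Rightarrow> real" where
  "multilinear_coeff f = (THE a. is_multilinear_rep f a)"

lemma unanimity_eq: "unanimity T x = (if T \<subseteq> x then 1 else 0)" for T :: "'n::finite set"
proof (cases "T \<subseteq> x")
  case True
  then show ?thesis by (auto simp: unanimity_def indicator_def intro!: prod.neutral)
next
  case False
  then obtain i where "i \<in> T" "i \<notin> x" by blast
  then have "(\<Prod>i\<in>T. indicator x i :: real) = 0"
    by (intro prod_zero) (auto intro!: bexI[of _ i])
  with False show ?thesis by (simp add: unanimity_def)
qed

lemma is_multilinear_rep_iff:
  "is_multilinear_rep f a \<longleftrightarrow> (\<forall>x. f x = (\<Sum>T\<in>Pow x. a T))"
  for f :: "'n::finite pseudo_boolean"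
proof -
  have "(\<Sum>T\<in>UNIV. a T * unanimity T x) = (\<Sum>T\<in>Pow x. a T)" for x :: "'n set"
    by (rule sum.mono_neutral_cong_right) (auto simp: unanimity_eq)
  then show ?thesis by (simp add: is_multilinear_rep_def fun_eq_iff)
qed

lemma multilinear_rep_unique:
  fixes f :: "'n::finite pseudo_boolean"
  assumes "is_multilinear_rep f a" "is_multilinear_rep f b"
  shows "a = b"
proof
  fix x :: "'n set"
  have "finite x" by simp
  then show "a x = b x"
  proof (induction x rule: finite_psubset_induct)
    case (psubset x)
    have split: "(\<Sum>T\<in>Pow x. c T) = c x + (\<Sum>T\<in>Pow x - {x}. c T)" for c :: "'n set \<Rightarrow> real"
      by (rule sum.remove) auto
    have "(\<Sum>T\<in>Pow x. a T) = (\<Sum>T\<in>Pow x. b T)"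
      using assms by (metis is_multilinear_rep_iff)
    moreover have "(\<Sum>T\<in>Pow x - {x}. a T) = (\<Sum>T\<in>Pow x - {x}. b T)"
      using psubset.IH by (intro sum.cong) auto
    ultimately show ?case by (simp add: split)
  qed
qed

lemma multilinear_rep_exists:
  fixes f :: "'n::finite pseudo_boolean"
  shows "\<exists>a. is_multilinear_rep f a"
proof -
  define a where
    "a = wfrec finite_psubset (\<lambda>a x. f x - (\<Sum>T\<in>Pow x - {x}. a T))"
  have "a x = f x - (\<Sum>T\<in>Pow x - {x}. a T)" for x
  proof -
    have "a x = f x - (\<Sum>T\<in>Pow x - {x}. cut a finite_psubset x T)"
      unfolding a_def by (subst wfrec[OF wf_finite_psubset]) simp
    also have "\<dots> = f x - (\<Sum>T\<in>Pow x - {x}. a T)"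
      by (intro arg_cong[where f = "\<lambda>s. f x - s"] sum.cong refl)
         (auto simp: cut_def finite_psubset_def)
    finally show ?thesis .
  qed
  moreover have "(\<Sum>T\<in>Pow x. a T) = a x + (\<Sum>T\<in>Pow x - {x}. a T)" for x
    by (rule sum.remove) auto
  ultimately have "f x = (\<Sum>T\<in>Pow x. a T)" for x
    by (metis add_diff_cancel_right' diff_add_cancel)
  then show ?thesis by (auto simp: is_multilinear_rep_iff)
qed

lemma is_multilinear_rep_multilinear_coeff: "is_multilinear_rep f (multilinear_coeff f)"
  unfolding multilinear_coeff_def
  using multilinear_rep_exists multilinear_rep_unique by (metis theI)

definition delta1 :: "'n \<Rightarrow> 'n pseudo_boolean \<Rightarrow> 'n pseudo_boolean" where
  "delta1 i f x = f (insert i x) - f (x - {i})"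

text \<open>The operators \<open>delta1 i\<close> commute, so the fold below is independent of the order in which
  the elements of \<open>S\<close> are taken.\<close>

definition delta :: "'n set \<Rightarrow> 'n pseudo_boolean \<Rightarrow> 'n pseudo_boolean" where
  "delta S f = Finite_Set.fold delta1 f S"

lemma comp_fun_commute_delta1: "comp_fun_commute delta1"
proof
  fix i j :: 'n
  show "delta1 i \<circ> delta1 j = delta1 j \<circ> delta1 i"
  proof (cases "i = j")
    case False
    then show ?thesis
      by (simp add: fun_eq_iff delta1_def insert_commute insert_Diff_if Diff_insert2 [symmetric])
  qed simp
qed

lemma delta_empty: "delta {} f = f"
  by (simp add: delta_def)

lemma delta_rec:
  fixes S :: "'n::finite set"
  assumes "i \<in> S"
  shows "delta S f = delta1 i (delta (S - {i}) f)"
  using comp_fun_commute_on.fold_rec[of UNIV delta1 S i f] comp_fun_commute_delta1 assms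
  by (auto simp: delta_def comp_fun_commute_def')

definition banzhaf_interaction :: "'n::finite pseudo_boolean \<Rightarrow> 'n set \<Rightarrow> real" where
  "banzhaf_interaction f S =
     1 / 2 ^ (CARD('n) - card S) * (\<Sum>T\<in>Pow (UNIV - S). delta S f T)"

global_interpretation pbf: vector_space "\<lambda>(c::real) (f::'n pseudo_boolean) x. c * f x"
  by unfold_locales (auto simp: fun_eq_iff algebra_simps)

definition V_space :: "'n set \<Rightarrow> 'n pseudo_boolean set" where
  "V_space S = pbf.span {unanimity T | T. T \<subseteq> S}"

definition is_best_approx ::
    "'n set \<Rightarrow> 'n::finite pseudo_boolean \<Rightarrow> 'n pseudo_boolean \<Rightarrow> bool" where
  "is_best_approx S f h \<longleftrightarrow>
     h \<in> V_space S \<and> (\<forall>g\<in>V_space S. (\<Sum>T\<in>UNIV. (f T - h T)\<^sup>2) \<le> (\<Sum>T\<in>UNIV. (f T - g T)\<^sup>2))"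

definition best_approx :: "'n set \<Rightarrow> 'n::finite pseudo_boolean \<Rightarrow> 'n pseudo_boolean" where
  "best_approx S f = (THE h. is_best_approx S f h)"

lemma best_approx_ex1:
  fixes f :: "'n::finite pseudo_boolean"
  shows "\<exists>!h. is_best_approx S f h"
proof -
  define W where "W = (vec_lambda ` V_space S :: (real ^ 'n set) set)"
  have sub: "subspace W"
  proof -
    have V: "pbf.subspace (V_space S)" by (simp add: V_space_def)
    have "0 \<in> W"
      using pbf.subspace_0[OF V] by (auto simp: W_def vec_eq_iff intro!: image_eqI[of _ _ 0])
    moreover have "p + q \<in> W" if pq: "p \<in> W" "q \<in> W" for p q
    proof -
      obtain g h where "g \<in> V_space S" "h \<in> V_space S" "p = vec_lambda g" "q = vec_lambda h"
        using pq by (auto simp: W_def)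
      then show ?thesis
        using pbf.subspace_add[OF V] by (auto simp: W_def vec_eq_iff intro!: image_eqI[of _ _ "g + h"])
    qed
    moreover have "c *\<^sub>R p \<in> W" if p: "p \<in> W" for c p
    proof -
      obtain g where "g \<in> V_space S" "p = vec_lambda g"
        using p by (auto simp: W_def)
      then show ?thesis
        using pbf.subspace_scale[OF V]
        by (auto simp: W_def vec_eq_iff intro!: image_eqI[of _ _ "\<lambda>x. c * g x"])
    qed
    ultimately show ?thesis by (auto simp: subspace_def)
  qed
  have cl: "closed W" "convex W" "W \<noteq> {}"
    using sub closed_subspace subspace_imp_convex subspace_0 by auto
  have W_iff: "vec_lambda g \<in> W \<longleftrightarrow> g \<in> V_space S" for g
    by (auto simp: W_def vec_lambda_inject)
  have d: "dist (vec_lambda f) (vec_lambda g :: real ^ 'n set) = sqrt (\<Sum>T\<in>UNIV. (f T - g T)\<^sup>2)" for g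
    by (simp add: dist_vec_def L2_set_def dist_real_def)
  have best: "is_best_approx S f h \<longleftrightarrow>
      vec_lambda h \<in> W \<and> (\<forall>w\<in>W. dist (vec_lambda f) (vec_lambda h) \<le> dist (vec_lambda f) w)" for h
    unfolding is_best_approx_def W_iff by (simp add: W_def d)
  let ?c = "closest_point W (vec_lambda f)"
  have "is_best_approx S f (vec_nth ?c)"
    unfolding best using closest_point_exists[OF cl(1,3), of "vec_lambda f"] by simp
  moreover have "h = vec_nth ?c" if "is_best_approx S f h" for h
    using closest_point_unique[OF cl(2,1), of "vec_lambda h" "vec_lambda f"] that
    unfolding best by (metis vec_lambda_inverse UNIV_I)
  ultimately show ?thesis by blast
qed

lemma is_best_approx_best_approx: "is_best_approx S f (best_approx S f)"
  unfolding best_approx_def by (rule theI'[OF best_approx_ex1])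

end

theory Submission
  imports Defs
begin

text \<open>
  Both sides are multiples of the inner product with the character
  \<open>x \<mapsto> \<Prod>i\<in>S. (2 * x\<^sub>i - 1)\<close>. Its inner product with \<open>f\<close> is \<open>2 ^ (n - card S)\<close> times the Banzhaf
  interaction index of \<open>f\<close>. The character lies in the space \<open>V_space S\<close>, so by orthogonality of the
  residual it has the same inner product with the best approximation, which depends on \<open>S\<close> only;
  there the value is \<open>2 ^ (n - card S)\<close> times the leading coefficient, by Moebius inversion.
\<close>

text \<open>The character mentioned above: each coordinate of \<open>x\<close> in \<open>S\<close>
  that is 0 contributes a factor -1, the others a factor 1.\<close>

definition parity_sign :: "'n set \<Rightarrow> 'n pseudo_boolean" where
  "parity_sign S x = (- 1) ^ card (S - x)"

text \<open>Induction on \<open>S\<close>: subsets of \<open>insert i S\<close> containing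
  \<open>i\<close> assemble to the value at \<open>insert i T\<close>, and those omitting
  \<open>i\<close>, with one extra sign, to minus the value at \<open>T - {i}\<close>. These are the
  two terms of \<open>delta1\<close>.\<close>

lemma delta_explicit:
  fixes S :: "'n::finite set"
  shows "delta S f T = (\<Sum>R\<in>Pow S. parity_sign S R * f (T - S \<union> R))"
proof -
  have "finite S" by simp
  then show ?thesis
  proof (induction S arbitrary: T rule: finite_induct)
    case empty
    then show ?case by (simp add: delta_empty parity_sign_def)
  next
    case (insert i S)
    have rec: "delta (insert i S) f = delta1 i (delta S f)"
      using delta_rec[of i "insert i S" f] insert.hyps by simp
    have upper: "(\<Sum>R\<in>insert i ` Pow S. parity_sign (insert i S) R * f (T - insert i S \<union> R))
        = delta S f (insert i T)"
    proof -
      have "inj_on (insert i) (Pow S)"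
        using insert.hyps by (auto simp: inj_on_def)
      moreover have "insert i S - insert i R = S - R" "T - insert i S \<union> insert i R = insert i T - S \<union> R"
        if "R \<subseteq> S" for R
        using that insert.hyps by auto
      ultimately show ?thesis
        by (auto simp: sum.reindex insert.IH parity_sign_def intro!: sum.cong)
    qed
    have lower: "(\<Sum>R\<in>Pow S. parity_sign (insert i S) R * f (T - insert i S \<union> R))
        = - delta S f (T - {i})"
    proof -
      have "card (insert i S - R) = Suc (card (S - R))" "T - insert i S \<union> R = T - {i} - S \<union> R"
        if "R \<subseteq> S" for R
        using that insert.hyps by (auto simp: insert_Diff_if)
      then show ?thesis
        by (auto simp: insert.IH parity_sign_def sum_negf[symmetric] intro!: sum.cong)
    qed
    have "Pow S \<inter> insert i ` Pow S = {}"
      using insert.hyps by auto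
    then show ?case
      by (simp add: rec delta1_def Pow_insert sum.union_disjoint upper lower)
  qed
qed

lemma sum_UNIV_split:
  fixes S :: "'n::finite set" and g :: "'n set \<Rightarrow> 'a::comm_monoid_add"
  shows "(\<Sum>x\<in>UNIV. g x) = (\<Sum>T\<in>Pow (UNIV - S). \<Sum>R\<in>Pow S. g (T \<union> R))"
  unfolding sum.cartesian_product
  by (rule sum.reindex_bij_witness[of _ "\<lambda>(T, R). T \<union> R" "\<lambda>x. (x - S, x \<inter> S)"])
     (auto simp: Un_commute Int_Diff_Un Un_Diff_Int)

lemma parity_sign_Un:
  "T \<subseteq> UNIV - S \<Longrightarrow> parity_sign S (T \<union> R) = parity_sign S R"
  by (auto simp: parity_sign_def intro!: arg_cong[where f = "\<lambda>A. (- 1) ^ card A"])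

text \<open>The points \<open>T \<union> R\<close> with \<open>T\<close> outside and
  \<open>R\<close> inside \<open>S\<close> run through the whole cube once, and the sign sees only
  \<open>R\<close>.\<close>

lemma sum_delta_eq_inner_parity_sign:
  fixes S :: "'n::finite set"
  shows "(\<Sum>T\<in>Pow (UNIV - S). delta S f T) = (\<Sum>x\<in>UNIV. parity_sign S x * f x)"
  unfolding sum_UNIV_split[of _ S]
proof (rule sum.cong[OF refl])
  fix T assume T: "T \<in> Pow (UNIV - S)"
  then have "T - S = T" by auto
  with T show "delta S f T = (\<Sum>R\<in>Pow S. parity_sign S (T \<union> R) * f (T \<union> R))"
    by (simp add: delta_explicit parity_sign_Un)
qed

text \<open>Turns the span into a pointwise test. For the converse, evaluating the multilinear
  representation at \<open>x \<inter> S\<close> leaves only monomials with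
  \<open>T \<subseteq> S\<close>.\<close>

lemma V_space_iff:
  fixes S :: "'n::finite set"
  shows "g \<in> V_space S \<longleftrightarrow> (\<forall>x. g x = g (x \<inter> S))"
proof
  assume "g \<in> V_space S"
  then show "\<forall>x. g x = g (x \<inter> S)"
    unfolding V_space_def
    by (induction rule: pbf.span_induct_alt) (auto simp: unanimity_eq)
next
  assume g: "\<forall>x. g x = g (x \<inter> S)"
  obtain a where a: "\<And>x. g x = (\<Sum>T\<in>Pow x. a T)"
    using multilinear_rep_exists[of g] by (auto simp: is_multilinear_rep_iff)
  have "g x = (\<Sum>T\<in>Pow S. a T * unanimity T x)" for x
  proof -
    have "g x = (\<Sum>T\<in>Pow (x \<inter> S). a T)"
      using g a by metis
    also have "\<dots> = (\<Sum>T\<in>Pow S. a T * unanimity T x)"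
      by (rule sum.mono_neutral_cong_left) (auto simp: unanimity_eq)
    finally show ?thesis .
  qed
  moreover have "(\<Sum>T\<in>Pow S. (\<lambda>x. a T * unanimity T x)) \<in> V_space S"
    unfolding V_space_def by (intro pbf.span_sum pbf.span_scale pbf.span_base) auto
  \<comment> \<open>The membership just shown concerns a sum of functions; this evaluates such a sum
    at a point.\<close>
  moreover have "(\<Sum>T\<in>A. (\<lambda>x. a T * unanimity T x)) x = (\<Sum>T\<in>A. a T * unanimity T x)"
    if "finite A" for A x
    using that by (induction A) auto
  ultimately show "g \<in> V_space S"
    by (metis (no_types, lifting) ext finite)
qed

text \<open>Variational argument: moving \<open>h\<close> by \<open>t * g\<close> stays in the
  space, so it cannot decrease the squared error.\<close>

lemma best_approx_residual_orthogonal: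
  assumes h: "is_best_approx S f h" and g: "g \<in> V_space S"
  shows "(\<Sum>x\<in>UNIV. g x * (f x - h x)) = 0"
proof -
  define b where "b = (\<Sum>x\<in>UNIV. g x * (f x - h x))"
  define c where "c = (\<Sum>x\<in>UNIV. (g x)\<^sup>2)"
  have "c \<ge> 0" by (simp add: c_def sum_nonneg)
  \<comment> \<open>The optimal step would be \<open>b / c\<close>; the denominator
    \<open>c + 1\<close> also covers \<open>c = 0\<close> and still forces
    \<open>t = 0\<close>.\<close>
  define t where "t = b / (c + 1)"
  have "(\<lambda>x. h x + t * g x) \<in> V_space S"
    using h g by (auto simp: is_best_approx_def V_space_iff)
  then have "(\<Sum>x\<in>UNIV. (f x - h x)\<^sup>2) \<le> (\<Sum>x\<in>UNIV. (f x - (h x + t * g x))\<^sup>2)"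
    using h by (auto simp: is_best_approx_def)
  also have "\<dots> = (\<Sum>x\<in>UNIV. (f x - h x)\<^sup>2 + (t\<^sup>2 * (g x)\<^sup>2 - 2 * t * (g x * (f x - h x))))"
    by (intro sum.cong) (auto simp: power2_eq_square algebra_simps)
  also have "\<dots> = (\<Sum>x\<in>UNIV. (f x - h x)\<^sup>2) + (t\<^sup>2 * c - 2 * t * b)"
    by (simp add: b_def c_def sum.distrib sum_subtractf sum_distrib_left)
  finally have "2 * t * b \<le> t\<^sup>2 * c" by simp
  moreover have "b = t * (c + 1)"
    using \<open>c \<ge> 0\<close> by (simp add: t_def)
  ultimately have "t\<^sup>2 * (c + 2) \<le> 0"
    by (simp add: power2_eq_square algebra_simps)
  then have "t = 0"
    using \<open>c \<ge> 0\<close> by (simp add: mult_le_0_iff)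
  with \<open>b = t * (c + 1)\<close> show ?thesis by (simp add: b_def)
qed

lemma multilinear_coeff_eq:
  "multilinear_coeff h S = (\<Sum>R\<in>Pow S. parity_sign S R * h R)"
  for h :: "'n::finite pseudo_boolean"
proof -
  have "multilinear_coeff h S = (\<Sum>R\<in>Pow S. (- 1) ^ (card S - card R) * h R)"
  proof (rule inclusion_exclusion_mobius)
    show "h T = sum (multilinear_coeff h) (Pow T)" for T
      using is_multilinear_rep_multilinear_coeff[of h] is_multilinear_rep_iff by blast
  qed simp
  also have "\<dots> = (\<Sum>R\<in>Pow S. parity_sign S R * h R)"
    by (intro sum.cong) (auto simp: parity_sign_def card_Diff_subset)
  finally show ?thesis .
qed

text \<open>Both factors ignore coordinates outside \<open>S\<close>, so the Moebius sum for the
  coefficient is repeated once for each subset of the complement.\<close>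

lemma inner_parity_sign_V_space:
  fixes S :: "'n::finite set"
  assumes "h \<in> V_space S"
  shows "(\<Sum>x\<in>UNIV. parity_sign S x * h x) = 2 ^ (CARD('n) - card S) * multilinear_coeff h S"
proof -
  have "h (T \<union> R) = h R" if "T \<subseteq> UNIV - S" "R \<subseteq> S" for T R
  proof -
    have "(T \<union> R) \<inter> S = R" using that by auto
    then show ?thesis using assms by (metis V_space_iff)
  qed
  then have "(\<Sum>x\<in>UNIV. parity_sign S x * h x)
      = (\<Sum>T\<in>Pow (UNIV - S). \<Sum>R\<in>Pow S. parity_sign S R * h R)"
    unfolding sum_UNIV_split[of _ S]
    by (intro sum.cong refl) (auto simp: parity_sign_Un)
  then show ?thesis
    by (simp add: multilinear_coeff_eq card_Pow card_Diff_subset)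
qed

theorem proposition2p2:
  fixes f :: "'n::finite pseudo_boolean" and S :: "'n set"
  shows "banzhaf_interaction f S = multilinear_coeff (best_approx S f) S"
proof -
  define h where "h = best_approx S f"
  have h: "is_best_approx S f h"
    by (simp add: h_def is_best_approx_best_approx)
  have "parity_sign S \<in> V_space S"
    by (simp add: V_space_iff parity_sign_def Diff_Int)
  from best_approx_residual_orthogonal[OF h this]
  have "(\<Sum>x\<in>UNIV. parity_sign S x * f x) = (\<Sum>x\<in>UNIV. parity_sign S x * h x)"
    by (simp add: right_diff_distrib sum_subtractf)
  also have "\<dots> = 2 ^ (CARD('n) - card S) * multilinear_coeff h S"
    using h by (intro inner_parity_sign_V_space) (simp add: is_best_approx_def)
  \<comment> \<open>The power of 2 cancels against the normalisation of the index.\<close>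
  finally show ?thesis
    by (simp add: banzhaf_interaction_def sum_delta_eq_inner_parity_sign h_def)
qed

end
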